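(* Let $\mathcal{C}\subseteq\mathbb{S}_n$ be a $2$-balanced code and let $A_n\le\mathbb{S}_n$ be the subgroup of even permutations. Then $\mathcal{C}=\{\sigma\pi:\pi\in A_n\}$ for some $\sigma\in\mathbb{S}_n$ (i.e. $\mathcal{C}$ is a coset of $A_n$).
   Context: $\mathbb{S}_n$ is the group of permutations of $[n]=\{1,\dots,n\}$, written in one-line notation. The Kendall-$\tau$ distance $\mathrm{d}_\mathrm{K}(\sigma,\tau)$ is the minimum number of adjacent transpositions (swaps of two consecutive entries in one-line notation) needed to obtain $\sigma$ from $\tau$. A code is a subset $\mathcal{C}\subseteq\mathbb{S}_n$ with $|\mathcal{C}|\ge2$, with minimum distance $\mathrm{d}_\mathrm{K}(\mathcal{C})=\min\{\mathrm{d}_\mathrm{K}(\sigma,\tau):\sigma\ne\tau\in\mathcal{C}\}$. A code $\mathcal{C}\subseteq\mathbb{S}_n$ is $2$-balanced if $\mathrm{d}_\mathrm{K}(\mathcal{C})>1$ and $|\mathcal{C}|=n!/2$. Since $A_n$ is normal, left and right cosets of $A_n$ coincide. *)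

theory Defs
  imports Complex_Main "HOL-Algebra.Sym_Groups"
begin

text \<open>The one-line notation of \<open>\<sigma>\<close> is the word \<open>\<sigma> 1, \<dots>, \<sigma> n\<close>, so an adjacent
  transposition exchanges the values at the positions \<open>i\<close> and \<open>i + 1\<close>.\<close>

definition adj_swap :: "nat \<Rightarrow> ((nat \<Rightarrow> nat) \<times> (nat \<Rightarrow> nat)) set" where
  "adj_swap n = {(\<tau>, \<tau>(i := \<tau> (i + 1), i + 1 := \<tau> i)) | \<tau> i.
     \<tau> \<in> carrier (sym_group n) \<and> 1 \<le> i \<and> i < n}"

definition kendall_dist :: "nat \<Rightarrow> (nat \<Rightarrow> nat) \<Rightarrow> (nat \<Rightarrow> nat) \<Rightarrow> nat" where
  "kendall_dist n \<sigma> \<tau> = (LEAST k. (\<tau>, \<sigma>) \<in> adj_swap n ^^ k)"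

definition perm_code :: "nat \<Rightarrow> (nat \<Rightarrow> nat) set \<Rightarrow> bool" where
  "perm_code n C \<longleftrightarrow> C \<subseteq> carrier (sym_group n) \<and> card C \<ge> 2"

definition min_kendall_dist :: "nat \<Rightarrow> (nat \<Rightarrow> nat) set \<Rightarrow> nat" where
  "min_kendall_dist n C = Min {kendall_dist n \<sigma> \<tau> | \<sigma> \<tau>. \<sigma> \<in> C \<and> \<tau> \<in> C \<and> \<sigma> \<noteq> \<tau>}"

definition two_balanced :: "nat \<Rightarrow> (nat \<Rightarrow> nat) set \<Rightarrow> bool" where
  "two_balanced n C \<longleftrightarrow>
     perm_code n C \<and> min_kendall_dist n C > 1 \<and> real (card C) = fact n / 2"

end

theory Submission
  imports Defs
begin

text \<open>Right multiplication by an adjacent transposition maps \<open>C\<close> injectively into its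
  complement, because two codewords are never at distance 1. As \<open>C\<close> contains exactly half of
  the permutations, this map is onto the complement, so every adjacent transposition
  exchanges \<open>C\<close> and its complement. Every transposition is a product of an odd number of
  adjacent ones and therefore does the same, and so right multiplication by \<open>\<pi>\<close> preserves
  \<open>C\<close> if \<open>\<pi>\<close> is even and exchanges it with its complement otherwise.\<close>

text \<open>The size condition is doubled so that it becomes an equation between natural numbers,
  free of division.\<close>

lemma two_balancedD:
  assumes "two_balanced n C"
  shows "C \<subseteq> {p. p permutes {1..n}}" "2 * card C = fact n" "C \<noteq> {}" "finite C"
proof -
  show sub: "C \<subseteq> {p. p permutes {1..n}}"
    using assms by (auto simp: two_balanced_def perm_code_def sym_group_def)
  have "real (2 * card C) = real (fact n)"
    using assms by (simp add: two_balanced_def)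
  then show "2 * card C = fact n"
    by (simp only: of_nat_eq_iff)
  show "C \<noteq> {}"
    using assms by (auto simp: two_balanced_def perm_code_def)
  show "finite C"
    using sub by (rule finite_subset) (simp add: finite_permutations)
qed

text \<open>Composing on the right acts on positions, so the product is one \<open>adj_swap\<close>
  step away from \<open>\<tau>\<close>; the least number of steps is then at most 1.\<close>

lemma kendall_dist_adjacent_le_1:
  assumes "\<tau> permutes {1..n}" "1 \<le> i" "i < n"
  shows "kendall_dist n (\<tau> \<circ> transpose i (i + 1)) \<tau> \<le> 1"
proof -
  have "\<tau> \<circ> transpose i (i + 1) = \<tau>(i := \<tau> (i + 1), i + 1 := \<tau> i)"
    by (auto simp: fun_eq_iff transpose_def)
  then have "(\<tau>, \<tau> \<circ> transpose i (i + 1)) \<in> adj_swap n ^^ 1"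
    using assms by (auto simp: adj_swap_def sym_group_def)
  then show ?thesis
    unfolding kendall_dist_def by (rule Least_le)
qed

lemma two_balanced_adjacent_notin:
  assumes C: "two_balanced n C" and "\<tau> \<in> C" "1 \<le> i" "i < n"
  shows "\<tau> \<circ> transpose i (i + 1) \<notin> C"
proof
  assume in_C: "\<tau> \<circ> transpose i (i + 1) \<in> C"
  define D where "D = {kendall_dist n \<sigma> \<tau> | \<sigma> \<tau>. \<sigma> \<in> C \<and> \<tau> \<in> C \<and> \<sigma> \<noteq> \<tau>}"
  have perm: "\<tau> permutes {1..n}"
    using two_balancedD(1)[OF C] \<open>\<tau> \<in> C\<close> by auto
  \<comment> \<open>The minimum ranges over distinct codewords only, so the swap must really change
    \<open>\<tau>\<close>.\<close>
  have "\<tau> (i + 1) \<noteq> \<tau> i"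
    using permutes_inj[OF perm] by (simp add: inj_eq)
  then have "\<tau> \<circ> transpose i (i + 1) \<noteq> \<tau>"
    by (metis comp_apply transpose_apply_first)
  then have "kendall_dist n (\<tau> \<circ> transpose i (i + 1)) \<tau> \<in> D"
    using in_C \<open>\<tau> \<in> C\<close> unfolding D_def by blast
  moreover have "finite D"
  proof (rule finite_subset)
    show "D \<subseteq> (\<lambda>(\<sigma>, \<tau>). kendall_dist n \<sigma> \<tau>) ` (C \<times> C)"
      by (auto simp: D_def)
  qed (simp add: two_balancedD(4)[OF C])
  ultimately have "Min D \<le> 1"
    using kendall_dist_adjacent_le_1[OF perm assms(3,4)] by (meson Min_le order_trans)
  then show False
    using C by (simp add: two_balanced_def min_kendall_dist_def D_def)
qed

lemma two_balanced_adjacent_iff: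
  assumes C: "two_balanced n C" and \<sigma>: "\<sigma> permutes {1..n}" and i: "1 \<le> i" "i < n"
  shows "\<sigma> \<circ> transpose i (i + 1) \<in> C \<longleftrightarrow> \<sigma> \<notin> C"
proof -
  let ?S = "{p. p permutes {1..n}}"
  let ?f = "\<lambda>\<tau>. \<tau> \<circ> transpose i (i + 1)"
  have invol: "?f (?f \<tau>) = \<tau>" for \<tau> :: "nat \<Rightarrow> nat"
    by (simp add: comp_assoc)
  have "transpose i (i + 1) permutes {1..n}"
    using i by (intro permutes_swap_id) auto
  then have "?f ` C \<subseteq> ?S - C"
    using two_balancedD(1)[OF C] two_balanced_adjacent_notin[OF C _ i]
    by (auto intro: permutes_compose)
  moreover have "card (?f ` C) = card C"
    by (rule card_image) (metis invol inj_on_inverseI)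
  moreover have "card (?S - C) = fact n - card C"
    using two_balancedD(1,4)[OF C] by (simp add: card_Diff_subset card_permutations)
  ultimately have image: "?f ` C = ?S - C"
    using two_balancedD(2)[OF C] by (intro card_subset_eq) (auto simp: finite_permutations)
  show ?thesis
  proof
    \<comment> \<open>This direction is where the size of \<open>C\<close> enters: by counting,
      \<open>\<sigma>\<close> is the image of a codeword \<open>\<tau>\<close>, and the involution
      \<open>?f\<close> leads back to \<open>\<tau>\<close>.\<close>
    assume "\<sigma> \<notin> C"
    then have "\<sigma> \<in> ?f ` C"
      unfolding image using \<sigma> by blast
    then obtain \<tau> where "\<tau> \<in> C" "\<sigma> = ?f \<tau>"
      by blast
    then show "?f \<sigma> \<in> C"
      by (simp only: invol)
  qed (use two_balanced_adjacent_notin[OF C _ i] in blast)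
qed

text \<open>Induction on \<open>b\<close>: conjugating \<open>transpose a b\<close> by the adjacent
  transposition of \<open>b\<close> and \<open>b + 1\<close> moves \<open>b\<close> to
  \<open>b + 1\<close>. Membership thus flips three times, which amounts to one flip. The induction
  hypothesis is needed at \<open>\<sigma> \<circ> ?s\<close>, so \<open>\<sigma>\<close> stays
  arbitrary.\<close>

lemma two_balanced_transpose_less_iff:
  assumes C: "two_balanced n C" and "1 \<le> a" "Suc a \<le> b"
  shows "b \<le> n \<Longrightarrow> \<sigma> permutes {1..n} \<Longrightarrow> \<sigma> \<circ> transpose a b \<in> C \<longleftrightarrow> \<sigma> \<notin> C"
  using \<open>Suc a \<le> b\<close>
proof (induction b arbitrary: \<sigma> rule: dec_induct)
  case base
  then show ?case
    using two_balanced_adjacent_iff[OF C, of \<sigma> a] \<open>1 \<le> a\<close>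
    by (metis Suc_eq_plus1 Suc_le_lessD)
next
  case (step b)
  let ?s = "transpose b (b + 1)"
  have ab: "1 \<le> b" "b < n" "a < b"
    using step \<open>1 \<le> a\<close> by auto
  have s: "?s permutes {1..n}" and t: "transpose a b permutes {1..n}"
    using ab \<open>1 \<le> a\<close> by (auto intro!: permutes_swap_id)
  have "transpose a (Suc b) = ?s \<circ> transpose a b \<circ> ?s"
    using ab by (auto simp: fun_eq_iff transpose_def)
  then have "\<sigma> \<circ> transpose a (Suc b) \<in> C \<longleftrightarrow> (\<sigma> \<circ> ?s) \<circ> transpose a b \<circ> ?s \<in> C"
    by (simp add: comp_assoc)
  also have "\<dots> \<longleftrightarrow> (\<sigma> \<circ> ?s) \<circ> transpose a b \<notin> C"
    using s t step.prems ab by (intro two_balanced_adjacent_iff[OF C] permutes_compose) auto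
  also have "\<dots> \<longleftrightarrow> \<sigma> \<circ> ?s \<in> C"
    using step.IH[OF _ permutes_compose[OF s]] step.prems by (metis Suc_leD)
  also have "\<dots> \<longleftrightarrow> \<sigma> \<notin> C"
    using step.prems ab by (intro two_balanced_adjacent_iff[OF C]) auto
  finally show ?case .
qed

lemma two_balanced_transpose_iff:
  assumes "two_balanced n C" "a \<in> {1..n}" "b \<in> {1..n}" "a \<noteq> b" "\<sigma> permutes {1..n}"
  shows "\<sigma> \<circ> transpose a b \<in> C \<longleftrightarrow> \<sigma> \<notin> C"
proof (cases "a < b")
  case True
  then show ?thesis
    using two_balanced_transpose_less_iff[of n C a b \<sigma>] assms by simp
next
  case False
  then show ?thesis
    using two_balanced_transpose_less_iff[of n C b a \<sigma>] assms
    by (simp add: transpose_commute)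
qed

text \<open>Induction on a factorization of \<open>\<pi>\<close> into transpositions: the leftmost
  factor is absorbed into \<open>\<sigma>\<close>, where it flips membership in \<open>C\<close>,
  while removing it flips the parity of \<open>\<pi>\<close>.\<close>

lemma two_balanced_comp_iff:
  assumes C: "two_balanced n C" and "\<pi> permutes {1..n}"
  shows "\<sigma> permutes {1..n} \<Longrightarrow> \<sigma> \<circ> \<pi> \<in> C \<longleftrightarrow> (\<sigma> \<in> C \<longleftrightarrow> evenperm \<pi>)"
  using assms(2) finite_atLeastAtMost
proof (induction \<pi> arbitrary: \<sigma> rule: permutes_induct)
  case id
  then show ?case by simp
next
  case (swap a b p)
  have t: "transpose a b permutes {1..n}"
    using swap by (auto intro: permutes_swap_id)
  have "permutation p"
    using swap.hyps by (auto simp: permutation_permutes)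
  then have "evenperm (transpose a b \<circ> p) \<longleftrightarrow> \<not> evenperm p"
    using swap.hyps by (simp add: evenperm_comp permutation_swap_id evenperm_swap)
  moreover have "\<sigma> \<circ> (transpose a b \<circ> p) \<in> C \<longleftrightarrow> (\<sigma> \<circ> transpose a b \<in> C \<longleftrightarrow> evenperm p)"
    using swap.IH[OF permutes_compose[OF t]] swap.prems by (metis comp_assoc)
  moreover have "\<sigma> \<circ> transpose a b \<in> C \<longleftrightarrow> \<sigma> \<notin> C"
    using swap by (intro two_balanced_transpose_iff[OF C]) auto
  ultimately show ?case by blast
qed

theorem theorem4p6:
  fixes n :: nat and C :: "(nat \<Rightarrow> nat) set"
  assumes "two_balanced n C"
  shows "\<exists>\<sigma> \<in> carrier (sym_group n).
           C = {\<sigma> \<otimes>\<^bsub>sym_group n\<^esub> \<pi> | \<pi>. \<pi> \<in> carrier (alt_group n)}"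
proof -
  \<comment> \<open>Any codeword can represent the coset: once \<open>\<sigma> \<in> C\<close>, the
    product \<open>\<sigma> \<circ> \<pi>\<close> lies in \<open>C\<close> exactly when
    \<open>\<pi>\<close> is even.\<close>
  obtain \<sigma> where \<sigma>: "\<sigma> \<in> C" "\<sigma> permutes {1..n}"
    using two_balancedD(1,3)[OF assms] by blast
  have "C = {\<sigma> \<circ> \<pi> | \<pi>. \<pi> permutes {1..n} \<and> evenperm \<pi>}"
  proof (intro equalityI subsetI)
    fix \<tau> assume "\<tau> \<in> C"
    \<comment> \<open>The only solution of \<open>\<tau> = \<sigma> \<circ> \<pi>\<close>; it is
      even because both \<open>\<sigma>\<close> and \<open>\<tau>\<close> are codewords.\<close>
    define \<pi> where "\<pi> = inv' \<sigma> \<circ> \<tau>"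
    have "\<tau> = \<sigma> \<circ> \<pi>"
      using permutes_inv_o(1)[OF \<sigma>(2)] by (simp add: \<pi>_def comp_assoc[symmetric])
    moreover have "\<pi> permutes {1..n}"
      using \<open>\<tau> \<in> C\<close> two_balancedD(1)[OF assms] \<sigma>(2)
      by (auto simp: \<pi>_def intro: permutes_compose permutes_inv)
    ultimately show "\<tau> \<in> {\<sigma> \<circ> \<pi> | \<pi>. \<pi> permutes {1..n} \<and> evenperm \<pi>}"
      using two_balanced_comp_iff[OF assms _ \<sigma>(2)] \<sigma>(1) \<open>\<tau> \<in> C\<close> by blast
  qed (use two_balanced_comp_iff[OF assms _ \<sigma>(2)] \<sigma>(1) in blast)
  then show ?thesis
    using \<sigma>(2) by (auto simp: sym_group_def alt_group_def)
qed

end
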